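(* Let $n\geq3$ and $2\leq k\leq n-1$. Then \[ (a^{(n)}_{\underline{i}})_{\underline{i}\in T^{k-1}_{n+1}}=\Omega\circ\Psi\left((a^{(n-1)}_{\underline{i}})_{\underline{i}\in T^{k-1}_{n}}\right). \]
   Context: $\mathbb N$ denotes the positive integers. For $d\geq1$, $N\geq d+1$, $T^d_N=\{(i_1,\ldots,i_{d+1})\in\mathbb N^{d+1}: i_1+\cdots+i_{d+1}=N\}$. A total cyclic order $\pi$ on $[m]=\{0,\ldots,m\}$ is a set of triples corresponding to a placement of the elements on a circle, with $(x,y,z)\in\pi$ iff $x,y,z$ are distinct and $y$ lies on the clockwise arc from $x$ to $z$; a tuple $(x_1,\ldots,x_r)$, $r\geq3$, of distinct elements is a $\pi$-chain if $(x_1,x_i,x_{i+1})\in\pi$ for $2\leq i\leq r-1$ (pairs are always chains). For $1\leq k\leq m$, $\hat{A}_{k,m}$ is the set of total cyclic orders $\pi$ on $[m]$ such that $(i,i+1,\ldots,i+k)$ is a $\pi$-chain for every $0\leq i\leq m-k$. For $i\neq j$ in $[m]$, $L_\pi(i,j)=1+\#\{h\in[m]:(i,h,j)\in\pi\}$. For $2\leq k\leq m$ and $\underline{i}=(i_1,\ldots,i_k)\in T^{k-1}_{m+1}$, let $\check{A}^{(m)}_{\underline{i}}$ be the set of $\pi\in\hat{A}_{k,m}$ with $L_\pi(m+j-k,m+1+j-k)=i_j$ for $1\leq j\leq k-1$ and $L_\pi(m,m+1-k)=i_k$, and $a^{(m)}_{\underline{i}}=\#\check{A}^{(m)}_{\underline{i}}$.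 For $\underline{i}=(i_1,\ldots,i_{d+1})\in T^d_{N+1}$, $\tau(\underline{i})$ is the set of $\underline{i'}=(i'_1,\ldots,i'_{d+1})\in T^d_N$ with $1\leq i'_1\leq i_1-1$, $i'_{d+1}=i_{d+1}+i_1-i'_1-1$, and $i'_j=i_j$ for $2\leq j\leq d$. The operator $\Psi$ sends an array $(b_{\underline{i}})_{\underline{i}\in T^d_N}$ to $(c_{\underline{i}})_{\underline{i}\in T^d_{N+1}}$ with $c_{\underline{i}}=\sum_{\underline{i'}\in\tau(\underline{i})}b_{\underline{i'}}$. The operator $\Omega$ sends $(b_{\underline{i}})_{\underline{i}\in T^d_N}$ to $(c_{\underline{i}})_{\underline{i}\in T^d_N}$ with $c_{(i_1,\ldots,i_{d+1})}=b_{(i_{d+1},i_1,\ldots,i_d)}$. Here $d=k-1$. *)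

theory Defs
  imports Main "HOL-Library.FuncSet"
begin

text \<open>Tuples are lists of natural numbers, so the entry $i_j$ of a tuple is \<open>i ! (j - 1)\<close>.
  An array indexed by \<open>T d N\<close> is a function that is extensional on \<open>T d N\<close>, so equality
  of such functions is equality of arrays.\<close>

definition T :: "nat \<Rightarrow> nat \<Rightarrow> nat list set" where
  "T d N = {i. length i = d + 1 \<and> (\<forall>x\<in>set i. 1 \<le> x) \<and> sum_list i = N}"

text \<open>The circle has positions $0, \dots, m$ numbered clockwise, and \<open>p x\<close> is the position of
  the element \<open>x\<close>; starting at \<open>p x\<close> and going clockwise one meets \<open>p y\<close> strictly
  before \<open>p z\<close> in exactly the three cases below.\<close>

definition total_cyclic_order :: "nat \<Rightarrow> (nat \<times> nat \<times> nat) set \<Rightarrow> bool" where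
  "total_cyclic_order m \<pi> \<longleftrightarrow>
     (\<exists>p. bij_betw p {0..m} {0..m} \<and>
       \<pi> = {(x, y, z). x \<in> {0..m} \<and> y \<in> {0..m} \<and> z \<in> {0..m} \<and>
              (p x < p y \<and> p y < p z \<or> p y < p z \<and> p z < p x \<or> p z < p x \<and> p x < p y)})"

definition is_chain :: "(nat \<times> nat \<times> nat) set \<Rightarrow> nat list \<Rightarrow> bool" where
  "is_chain \<pi> xs \<longleftrightarrow>
     distinct xs \<and> (\<forall>i. 2 \<le> i \<and> i \<le> length xs - 1 \<longrightarrow> (xs ! 0, xs ! (i - 1), xs ! i) \<in> \<pi>)"

definition A_hat :: "nat \<Rightarrow> nat \<Rightarrow> (nat \<times> nat \<times> nat) set set" where
  "A_hat k m =
     {\<pi>. total_cyclic_order m \<pi> \<and> (\<forall>i. i \<le> m - k \<longrightarrow> is_chain \<pi> [i..<i + k + 1])}"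

definition L :: "nat \<Rightarrow> (nat \<times> nat \<times> nat) set \<Rightarrow> nat \<Rightarrow> nat \<Rightarrow> nat" where
  "L m \<pi> i j = 1 + card {h \<in> {0..m}. (i, h, j) \<in> \<pi>}"

text \<open>The parameter $k$ of $\check{A}^{(m)}_{\underline{i}}$ is the length of the tuple.\<close>

definition A_check :: "nat \<Rightarrow> nat list \<Rightarrow> (nat \<times> nat \<times> nat) set set" where
  "A_check m i =
     (let k = length i in
      {\<pi> \<in> A_hat k m.
         (\<forall>j\<in>{1..k - 1}. L m \<pi> (m + j - k) (m + 1 + j - k) = i ! (j - 1)) \<and>
         L m \<pi> m (m + 1 - k) = i ! (k - 1)})"

definition a :: "nat \<Rightarrow> nat list \<Rightarrow> nat" where
  "a m i = card (A_check m i)"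

definition tau :: "nat \<Rightarrow> nat \<Rightarrow> nat list \<Rightarrow> nat list set" where
  "tau d N i =
     {i' \<in> T d N. 1 \<le> i' ! 0 \<and> i' ! 0 \<le> i ! 0 - 1 \<and>
        i' ! d = i ! d + i ! 0 - i' ! 0 - 1 \<and>
        (\<forall>j\<in>{2..d}. i' ! (j - 1) = i ! (j - 1))}"

definition Psi :: "nat \<Rightarrow> nat \<Rightarrow> (nat list \<Rightarrow> nat) \<Rightarrow> nat list \<Rightarrow> nat" where
  "Psi d N b = (\<lambda>i\<in>T d (N + 1). \<Sum>i'\<in>tau d N i. b i')"

definition Omega :: "nat \<Rightarrow> nat \<Rightarrow> (nat list \<Rightarrow> nat) \<Rightarrow> nat list \<Rightarrow> nat" where
  "Omega d N b = (\<lambda>i\<in>T d N. b (last i # butlast i))"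

end

theory Submission
  imports Defs
begin

text \<open>
  Deleting the element $n$ from $\pi \in \check{A}^{(n)}_{\underline{i}}$ leaves a cyclic order $\rho$
  on $[n-1]$. The last chain condition of $\pi$ says that the elements $n-k, \dots, n$ occur in
  this cyclic order, so $n$ lies on the arc from $n-1$ to $n-k$. Hence the arc lengths between
  consecutive elements of $n-k, \dots, n-1$ are unchanged, except that the arc from $n-1$ to
  $n-k$ becomes shorter by one, while the length $i_k$ from $n$ to $n-k+1$ splits at $n-k$.
  This is the relation between the indices expressed by $\Omega \circ \Psi$. Conversely, $n$ can
  be reinserted in exactly one way, at distance $i_{k-1}$ after $n-1$.
\<close>

section \<open>Cyclic orders through positions on a circle\<close>

definition cyclic_order_of :: "nat \<Rightarrow> (nat \<Rightarrow> nat) \<Rightarrow> (nat \<times> nat \<times> nat) set" where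
  "cyclic_order_of m p = {(x, y, z). x \<le> m \<and> y \<le> m \<and> z \<le> m \<and>
     (p x < p y \<and> p y < p z \<or> p y < p z \<and> p z < p x \<or> p z < p x \<and> p x < p y)}"

lemma total_cyclic_order_iff:
  "total_cyclic_order m \<pi> \<longleftrightarrow> (\<exists>p. bij_betw p {0..m} {0..m} \<and> \<pi> = cyclic_order_of m p)"
  by (simp add: total_cyclic_order_def cyclic_order_of_def)

lemma total_cyclic_order_carrier:
  assumes "total_cyclic_order m \<pi>" "(x, y, z) \<in> \<pi>"
  shows "x \<le> m" "y \<le> m" "z \<le> m"
  using assms by (auto simp: total_cyclic_order_def)

lemma total_cyclic_order_rotate:
  "total_cyclic_order m \<pi> \<Longrightarrow> (x, y, z) \<in> \<pi> \<Longrightarrow> (y, z, x) \<in> \<pi>"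
  by (auto simp: total_cyclic_order_def)

lemma total_cyclic_order_asym:
  "total_cyclic_order m \<pi> \<Longrightarrow> (x, y, z) \<in> \<pi> \<Longrightarrow> (x, z, y) \<notin> \<pi>"
  by (auto simp: total_cyclic_order_def)

lemma total_cyclic_order_distinct:
  "total_cyclic_order m \<pi> \<Longrightarrow> (x, y, z) \<in> \<pi> \<Longrightarrow> x \<noteq> y \<and> y \<noteq> z \<and> x \<noteq> z"
  by (auto simp: total_cyclic_order_def)

lemma total_cyclic_order_trans:
  assumes "total_cyclic_order m \<pi>" "(x, y, z) \<in> \<pi>" "(x, z, w) \<in> \<pi>"
  shows "(x, y, w) \<in> \<pi>" "(y, z, w) \<in> \<pi>"
  using assms by (auto simp: total_cyclic_order_def)

lemma total_cyclic_order_total: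
  assumes "total_cyclic_order m \<pi>" "x \<le> m" "y \<le> m" "z \<le> m" "x \<noteq> y" "y \<noteq> z" "x \<noteq> z"
  shows "(x, y, z) \<in> \<pi> \<or> (x, z, y) \<in> \<pi>"
proof -
  obtain p where p: "bij_betw p {0..m} {0..m}" "\<pi> = cyclic_order_of m p"
    using assms(1) by (auto simp: total_cyclic_order_iff)
  have "p x \<noteq> p y" "p y \<noteq> p z" "p x \<noteq> p z"
    using assms p(1) by (auto simp: bij_betw_def inj_on_def)
  then show ?thesis
    using assms unfolding p(2) cyclic_order_of_def by auto
qed

text \<open>Rotating the circle leaves the cyclic order unchanged, so any chosen element may serve
  as the origin; the order seen from \<open>b\<close> is then the linear order of positions.\<close>

lemma total_cyclic_order_normalize:
  assumes "total_cyclic_order m \<pi>" "b \<le> m"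
  obtains p where "bij_betw p {0..m} {0..m}" "p b = 0" "\<pi> = cyclic_order_of m p"
proof -
  obtain q where q: "bij_betw q {0..m} {0..m}" "\<pi> = cyclic_order_of m q"
    using assms(1) by (auto simp: total_cyclic_order_iff)
  \<comment> \<open>This is \<open>q x - q b\<close> modulo \<open>m + 1\<close>; the case split
    avoids truncated subtraction.\<close>
  define p where "p x = (if q x < q b then q x + m + 1 - q b else q x - q b)" for x
  have qm: "q x \<le> m" if "x \<le> m" for x
    using q(1) that by (auto simp: bij_betw_def)
  have inj: "inj_on p {0..m}"
  proof (rule inj_onI)
    fix x y assume xy: "x \<in> {0..m}" "y \<in> {0..m}" "p x = p y"
    then have "q x = q y"
      using qm[of x] qm[of y] qm[OF assms(2)] by (auto simp: p_def split: if_splits)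
    then show "x = y"
      using q(1) xy by (auto simp: bij_betw_def inj_on_def)
  qed
  have "p ` {0..m} \<subseteq> {0..m}"
  proof clarsimp
    fix x assume "x \<le> m"
    then show "p x \<le> m" using qm[of x] by (auto simp: p_def)
  qed
  with inj have "bij_betw p {0..m} {0..m}"
    by (simp add: bij_betw_def endo_inj_surj)
  moreover have "p b = 0" by (simp add: p_def)
  moreover have "\<pi> = cyclic_order_of m p"
  proof -
    \<comment> \<open>The rotation swaps the blocks \<open>q x < q b\<close> and
      \<open>q b \<le> q x\<close> and keeps the order inside each, which preserves cyclic
      triples.\<close>
    have less: "p x < p y \<longleftrightarrow>
      (if q x < q b then q x < q y \<and> q y < q b else q x < q y \<or> q y < q b)"
      if "x \<le> m" "y \<le> m" for x y
      using qm[OF that(1)] qm[OF that(2)] qm[OF assms(2)] by (auto simp: p_def)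
    have "(q x < q y \<and> q y < q z \<or> q y < q z \<and> q z < q x \<or> q z < q x \<and> q x < q y) \<longleftrightarrow>
      (p x < p y \<and> p y < p z \<or> p y < p z \<and> p z < p x \<or> p z < p x \<and> p x < p y)"
      if "x \<le> m" "y \<le> m" "z \<le> m" for x y z
      by (cases "q x < q b"; cases "q y < q b"; cases "q z < q b") (auto simp: less that)
    then show ?thesis
      unfolding q(2) cyclic_order_of_def by blast
  qed
  ultimately show ?thesis by (rule that)
qed

section \<open>Arc lengths\<close>

text \<open>Positions \<open>1\<close> to \<open>p x - 1\<close> are all occupied, exactly by the
  elements between \<open>b\<close> and \<open>x\<close>. Hence the positions can be recovered from
  the order itself.\<close>

lemma L_base:
  assumes "bij_betw p {0..m} {0..m}" "p b = 0" "b \<le> m" "x \<le> m" "x \<noteq> b"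
  shows "L m (cyclic_order_of m p) b x = p x"
proof -
  let ?S = "{h \<in> {0..m}. (b, h, x) \<in> cyclic_order_of m p}"
  have x: "0 < p x" "p x \<le> m"
    using assms by (auto simp: bij_betw_def inj_on_def) (metis atLeastAtMost_iff gr0I le0)
  have S: "?S = {h \<in> {0..m}. 0 < p h \<and> p h < p x}"
    using assms x by (auto simp: cyclic_order_of_def)
  have "p ` ?S = {0<..<p x}"
  proof -
    have "v \<in> p ` {h \<in> {0..m}. 0 < p h \<and> p h < p x}" if "0 < v" "v < p x" for v
    proof -
      have "v \<in> p ` {0..m}" using assms(1) that x by (auto simp: bij_betw_def)
      then show ?thesis using that by auto
    qed
    then show ?thesis unfolding S by auto
  qed
  moreover have "inj_on p ?S"
    using assms(1) by (auto simp: bij_betw_def inj_on_def)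
  ultimately have "card ?S = card {0<..<p x}"
    using card_image by fastforce
  then show ?thesis using x by (simp add: L_def)
qed

text \<open>The inside of the long arc is the disjoint union of \<open>y\<close> and the insides of
  the two short arcs; \<open>y\<close> accounts for the second \<open>1\<close> on the right-hand
  side.\<close>

lemma L_add:
  assumes \<pi>: "total_cyclic_order m \<pi>" and xyz: "(x, y, z) \<in> \<pi>"
  shows "L m \<pi> x z = L m \<pi> x y + L m \<pi> y z"
proof -
  let ?A = "{h \<in> {0..m}. (x, h, y) \<in> \<pi>}" and ?B = "{h \<in> {0..m}. (y, h, z) \<in> \<pi>}"
  note tr = total_cyclic_order_trans[OF \<pi>] and rot = total_cyclic_order_rotate[OF \<pi>]
    and dist = total_cyclic_order_distinct[OF \<pi>] and carr = total_cyclic_order_carrier[OF \<pi>]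
    and asym = total_cyclic_order_asym[OF \<pi>]
  have eq: "{h \<in> {0..m}. (x, h, z) \<in> \<pi>} = insert y (?A \<union> ?B)"
  proof (intro set_eqI iffI)
    fix h assume h: "h \<in> {h \<in> {0..m}. (x, h, z) \<in> \<pi>}"
    show "h \<in> insert y (?A \<union> ?B)"
    proof (cases "h = y")
      case False
      have "(x, h, y) \<in> \<pi> \<or> (x, y, h) \<in> \<pi>"
        using total_cyclic_order_total[OF \<pi>, of x h y] carr[OF xyz] dist[OF xyz] h dist[of x h z] False
        by auto
      then show ?thesis
        using h tr(2)[of x y h z] by auto
    qed simp
  next
    fix h assume "h \<in> insert y (?A \<union> ?B)"
    then consider "h = y" | "h \<le> m" "(x, h, y) \<in> \<pi>" | "h \<le> m" "(y, h, z) \<in> \<pi>" by auto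
    then show "h \<in> {h \<in> {0..m}. (x, h, z) \<in> \<pi>}"
    proof cases
      case 1
      then show ?thesis using xyz carr[OF xyz] by simp
    next
      case 2
      then show ?thesis using tr(1)[OF 2(2) xyz] by simp
    next
      case 3
      \<comment> \<open>The arc containing \<open>h\<close> starts at \<open>y\<close>, so the given
        triple is first rotated to start at \<open>y\<close>, where transitivity applies.\<close>
      have "(h, z, x) \<in> \<pi>" using tr(2)[OF 3(2) rot[OF xyz]] .
      then show ?thesis using 3 rot by simp
    qed
  qed
  have "?A \<inter> ?B = {}"
  proof (rule ccontr)
    assume "?A \<inter> ?B \<noteq> {}"
    then obtain h where h: "(x, h, y) \<in> \<pi>" "(y, h, z) \<in> \<pi>" by auto
    have "(h, y, z) \<in> \<pi>" by (rule tr(2)[OF h(1) xyz])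
    then show False using rot[OF h(2)] asym rot by blast
  qed
  moreover have "y \<notin> ?A \<union> ?B" using dist by auto
  ultimately have "card {h \<in> {0..m}. (x, h, z) \<in> \<pi>} = Suc (card ?A + card ?B)"
    unfolding eq by (simp add: card_Un_disjoint)
  then show ?thesis by (simp add: L_def)
qed

section \<open>Chains\<close>

text \<open>\<open>is_chain\<close> only compares consecutive entries as seen from the first one;
  transitivity at this fixed base point extends the comparison to all pairs.\<close>

lemma is_chain_nth:
  assumes \<pi>: "total_cyclic_order m \<pi>" and "is_chain \<pi> xs" "0 < i" "i < j" "j < length xs"
  shows "(xs ! 0, xs ! i, xs ! j) \<in> \<pi>"
  using assms(4,5)
proof (induction j)
  case (Suc j)
  have step: "(xs ! 0, xs ! j, xs ! Suc j) \<in> \<pi>"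
    using assms(2) Suc.prems assms(3) unfolding is_chain_def
    by (elim conjE allE[of _ "Suc j"]) auto
  show ?case
  proof (cases "i = j")
    case False
    then show ?thesis
      using total_cyclic_order_trans(1)[OF \<pi> Suc.IH step] Suc.prems by simp
  qed (use step in simp)
qed simp

lemma is_chain_upt_iff:
  assumes \<pi>: "total_cyclic_order m \<pi>"
  shows "is_chain \<pi> [u..<v + 1] \<longleftrightarrow> (\<forall>x y. u < x \<and> x < y \<and> y \<le> v \<longrightarrow> (u, x, y) \<in> \<pi>)"
proof
  assume ch: "is_chain \<pi> [u..<v + 1]"
  show "\<forall>x y. u < x \<and> x < y \<and> y \<le> v \<longrightarrow> (u, x, y) \<in> \<pi>"
  proof (intro allI impI)
    fix x y assume xy: "u < x \<and> x < y \<and> y \<le> v"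
    then show "(u, x, y) \<in> \<pi>"
      using is_chain_nth[OF \<pi> ch, of "x - u" "y - u"] by (simp add: less_diff_conv del: upt_Suc)
  qed
next
  assume *: "\<forall>x y. u < x \<and> x < y \<and> y \<le> v \<longrightarrow> (u, x, y) \<in> \<pi>"
  have "(u, u + (i - 1), u + i) \<in> \<pi>" if "2 \<le> i" "i \<le> v - u" for i
    by (rule *[rule_format]) (use that in auto)
  then show "is_chain \<pi> [u..<v + 1]"
    by (auto simp: is_chain_def simp del: upt_Suc)
qed

section \<open>Deleting and reinserting the largest element\<close>

definition restrict_order :: "nat \<Rightarrow> (nat \<times> nat \<times> nat) set \<Rightarrow> (nat \<times> nat \<times> nat) set" where
  "restrict_order m \<pi> = {(x, y, z) \<in> \<pi>. x \<le> m \<and> y \<le> m \<and> z \<le> m}"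

lemma total_cyclic_order_restrict:
  assumes "total_cyclic_order (Suc m) \<pi>"
  shows "total_cyclic_order m (restrict_order m \<pi>)"
proof -
  obtain p where p: "bij_betw p {0..Suc m} {0..Suc m}" "\<pi> = cyclic_order_of (Suc m) p"
    using assms by (auto simp: total_cyclic_order_iff)
  \<comment> \<open>Positions beyond the deleted element move down by one to close the gap.\<close>
  define q where "q x = (if p x < p (Suc m) then p x else p x - 1)" for x
  have pm: "p x \<le> Suc m" if "x \<le> Suc m" for x
    using p(1) that by (auto simp: bij_betw_def)
  have ne: "p x \<noteq> p (Suc m)" if "x \<le> m" for x
    using p(1) that inj_onD[of p "{0..Suc m}" x "Suc m"] by (auto simp: bij_betw_def)
  have mono: "q x < q y \<longleftrightarrow> p x < p y" if "x \<le> m" "y \<le> m" for x y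
    using ne[OF that(1)] ne[OF that(2)] by (auto simp: q_def)
  have "inj_on q {0..m}"
  proof (rule inj_onI)
    fix x y assume xy: "x \<in> {0..m}" "y \<in> {0..m}" "q x = q y"
    then have "p x = p y" using mono[of x y] mono[of y x] by auto
    then show "x = y" using p(1) xy by (auto simp: bij_betw_def inj_on_def)
  qed
  moreover have "q ` {0..m} \<subseteq> {0..m}"
  proof clarsimp
    fix x assume "x \<le> m"
    then show "q x \<le> m" using pm[of x] pm[of "Suc m"] ne[of x] by (auto simp: q_def)
  qed
  ultimately have "bij_betw q {0..m} {0..m}"
    by (simp add: bij_betw_def endo_inj_surj)
  moreover have "restrict_order m \<pi> = cyclic_order_of m q"
    unfolding p(2) restrict_order_def cyclic_order_of_def by (auto simp: mono)
  ultimately show ?thesis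
    by (auto simp: total_cyclic_order_iff)
qed

text \<open>With \<open>b\<close> at position \<open>0\<close>, the new element takes position
  \<open>c\<close> and the positions from \<open>c\<close> on move up by one. The bound
  \<open>1 \<le> c\<close> keeps \<open>b\<close> at the origin, and \<open>c \<le> Suc m\<close>
  keeps the new position on the circle.\<close>

lemma total_cyclic_order_insert:
  assumes "total_cyclic_order m \<pi>" "b \<le> m" "1 \<le> c" "c \<le> Suc m"
  obtains \<sigma> where "total_cyclic_order (Suc m) \<sigma>" "restrict_order m \<sigma> = \<pi>"
    "L (Suc m) \<sigma> b (Suc m) = c"
    "\<And>x. x \<le> m \<Longrightarrow> x \<noteq> b \<Longrightarrow> c \<le> L m \<pi> b x \<Longrightarrow> (b, Suc m, x) \<in> \<sigma>"
proof -
  obtain p where p: "bij_betw p {0..m} {0..m}" "p b = 0" "\<pi> = cyclic_order_of m p"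
    using total_cyclic_order_normalize[OF assms(1,2)] .
  define q where "q x = (if x = Suc m then c else if p x < c then p x else Suc (p x))" for x
  have pm: "p x \<le> m" if "x \<le> m" for x
    using p(1) that by (auto simp: bij_betw_def)
  have mono: "q x < q y \<longleftrightarrow> p x < p y" if "x \<le> m" "y \<le> m" for x y
    using that by (auto simp: q_def)
  have ne: "q x \<noteq> q (Suc m)" if "x \<le> m" for x
    using that by (auto simp: q_def)
  have "inj_on q {0..Suc m}"
  proof (rule inj_onI)
    fix x y assume xy: "x \<in> {0..Suc m}" "y \<in> {0..Suc m}" "q x = q y"
    show "x = y"
    proof (cases "x = Suc m \<or> y = Suc m")
      case True
      then show ?thesis using xy ne[of x] ne[of y] by (auto simp: le_Suc_eq)
    next
      case False
      then have "p x = p y" using xy mono[of x y] mono[of y x] by auto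
      then show ?thesis using p(1) xy False by (auto simp: bij_betw_def inj_on_def)
    qed
  qed
  moreover have "q ` {0..Suc m} \<subseteq> {0..Suc m}"
  proof clarsimp
    fix x assume "x \<le> Suc m"
    then show "q x \<le> Suc m" using pm[of x] assms(4) by (auto simp: q_def)
  qed
  ultimately have q: "bij_betw q {0..Suc m} {0..Suc m}"
    by (simp add: bij_betw_def endo_inj_surj)
  have qb: "q b = 0" using assms p(2) by (simp add: q_def)
  show ?thesis
  proof (rule that)
    show "total_cyclic_order (Suc m) (cyclic_order_of (Suc m) q)"
      using q by (auto simp: total_cyclic_order_iff)
    show "restrict_order m (cyclic_order_of (Suc m) q) = \<pi>"
      unfolding p(3) restrict_order_def cyclic_order_of_def by (auto simp: mono)
    show "L (Suc m) (cyclic_order_of (Suc m) q) b (Suc m) = c"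
      using L_base[OF q qb, of "Suc m"] assms(2) q_def[of "Suc m"] by simp
    show "(b, Suc m, x) \<in> cyclic_order_of (Suc m) q"
      if "x \<le> m" "x \<noteq> b" "c \<le> L m \<pi> b x" for x
      using L_base[OF p(1,2) assms(2) that(1,2)] that assms qb p(3)
      by (simp add: cyclic_order_of_def q_def)
  qed
qed

lemma L_restrict:
  assumes "x \<le> m" "y \<le> m"
  shows "L (Suc m) \<pi> x y = L m (restrict_order m \<pi>) x y + (if (x, Suc m, y) \<in> \<pi> then 1 else 0)"
proof -
  let ?S = "{h \<in> {0..m}. (x, h, y) \<in> restrict_order m \<pi>}"
  have "{h \<in> {0..Suc m}. (x, h, y) \<in> \<pi>} =
    (if (x, Suc m, y) \<in> \<pi> then insert (Suc m) ?S else ?S)"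
    using assms by (auto simp: restrict_order_def le_Suc_eq)
  moreover have "Suc m \<notin> ?S" by simp
  ultimately show ?thesis by (simp add: L_def)
qed

text \<open>Uniqueness of the reinsertion: with \<open>b\<close> at position \<open>0\<close> in
  both orders, positions are lengths from \<open>b\<close>, and these are determined by the
  restriction and the place of \<open>Suc m\<close>.\<close>

lemma restrict_order_inj:
  assumes \<pi>: "total_cyclic_order (Suc m) \<pi>" and \<sigma>: "total_cyclic_order (Suc m) \<sigma>"
    and eq: "restrict_order m \<pi> = restrict_order m \<sigma>"
    and b: "b \<le> m" "L (Suc m) \<pi> b (Suc m) = L (Suc m) \<sigma> b (Suc m)"
  shows "\<pi> = \<sigma>"
proof -
  have bS: "b \<le> Suc m" using b by simp
  obtain p where p: "bij_betw p {0..Suc m} {0..Suc m}" "p b = 0" "\<pi> = cyclic_order_of (Suc m) p"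
    using total_cyclic_order_normalize[OF \<pi> bS] .
  obtain q where q: "bij_betw q {0..Suc m} {0..Suc m}" "q b = 0" "\<sigma> = cyclic_order_of (Suc m) q"
    using total_cyclic_order_normalize[OF \<sigma> bS] .
  have Lp: "L (Suc m) \<pi> b x = p x" and Lq: "L (Suc m) \<sigma> b x = q x"
    if "x \<le> Suc m" "x \<noteq> b" for x
    using L_base[OF p(1,2) bS that] L_base[OF q(1,2) bS that] p(3) q(3) by auto
  have c: "p (Suc m) = q (Suc m)"
    using Lp[of "Suc m"] Lq[of "Suc m"] b by simp
  have pos: "0 < p (Suc m)" using Lp[of "Suc m"] b by (simp add: L_def)
  have "p x = q x" if x: "x \<le> Suc m" for x
  proof (cases "x = b \<or> x = Suc m")
    case True
    then show ?thesis using p(2) q(2) c by auto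
  next
    case False
    then have xm: "x \<le> m" using x by simp
    have "p x \<noteq> p (Suc m)" "q x \<noteq> q (Suc m)"
      using p(1) q(1) xm inj_onD[of p "{0..Suc m}" x "Suc m"] inj_onD[of q "{0..Suc m}" x "Suc m"]
      by (auto simp: bij_betw_def)
    moreover have "(b, Suc m, x) \<in> \<pi> \<longleftrightarrow> p (Suc m) < p x" "(b, Suc m, x) \<in> \<sigma> \<longleftrightarrow> q (Suc m) < q x"
      using p(2,3) q(2,3) bS x pos c by (auto simp: cyclic_order_of_def)
    \<comment> \<open>Let \<open>l\<close> be the length from \<open>b\<close> to \<open>x\<close>
      in the common restriction. In either order, \<open>x\<close> lies beyond \<open>Suc m\<close>
      iff \<open>l\<close> is at least the position of \<open>Suc m\<close>, and its position is
      then \<open>l + 1\<close>, otherwise \<open>l\<close>.\<close>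
    ultimately show ?thesis
      using L_restrict[OF b(1) xm, of \<pi>] L_restrict[OF b(1) xm, of \<sigma>] Lp[of x] Lq[of x] eq x False c
      by (auto split: if_splits)
  qed
  then show ?thesis unfolding p(3) q(3) cyclic_order_of_def by auto
qed

section \<open>Chain conditions and arc lengths under deletion\<close>

lemma is_chain_restrict:
  assumes "set xs \<subseteq> {0..m}"
  shows "is_chain (restrict_order m \<pi>) xs \<longleftrightarrow> is_chain \<pi> xs"
proof -
  have "xs ! i \<le> m" if "i < length xs" for i
    using assms nth_mem[OF that] by auto
  then show ?thesis
    by (cases "xs = []") (auto simp: is_chain_def restrict_order_def)
qed

text \<open>The windows of \<open>k + 1\<close> consecutive numbers inside \<open>{0..m}\<close> do
  not see \<open>Suc m\<close>; only the window ending at \<open>Suc m\<close> is new.\<close>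

lemma A_hat_Suc_iff:
  assumes "k \<le> m" and \<pi>: "total_cyclic_order (Suc m) \<pi>"
  shows "\<pi> \<in> A_hat k (Suc m) \<longleftrightarrow>
    restrict_order m \<pi> \<in> A_hat k m \<and> is_chain \<pi> [Suc m - k..<Suc m + 1]"
proof -
  have "is_chain (restrict_order m \<pi>) [i..<i + k + 1] \<longleftrightarrow> is_chain \<pi> [i..<i + k + 1]"
    if "i \<le> m - k" for i
    using that assms(1) by (intro is_chain_restrict) auto
  moreover have "(\<forall>i \<le> Suc m - k. is_chain \<pi> [i..<i + k + 1]) \<longleftrightarrow>
    (\<forall>i \<le> m - k. is_chain \<pi> [i..<i + k + 1]) \<and> is_chain \<pi> [Suc m - k..<Suc m + 1]"
    using assms(1) by (auto simp: Suc_diff_le le_Suc_eq)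
  ultimately show ?thesis
    using \<pi> total_cyclic_order_restrict[OF \<pi>] by (auto simp: A_hat_def)
qed

text \<open>The last chain of the restriction already orders all elements of the new window except
  \<open>Suc m\<close>, so only the place of \<open>Suc m\<close> relative to its two ends remains
  to be fixed.\<close>

lemma last_chain_iff:
  assumes k: "2 \<le> k" "k \<le> m" and \<pi>: "total_cyclic_order (Suc m) \<pi>"
    and r: "restrict_order m \<pi> \<in> A_hat k m"
  shows "is_chain \<pi> [Suc m - k..<Suc m + 1] \<longleftrightarrow> (m, Suc m, Suc m - k) \<in> \<pi>"
proof
  assume "is_chain \<pi> [Suc m - k..<Suc m + 1]"
  then have "(Suc m - k, m, Suc m) \<in> \<pi>"
    using k by (subst (asm) is_chain_upt_iff[OF \<pi>]) auto
  then show "(m, Suc m, Suc m - k) \<in> \<pi>"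
    by (rule total_cyclic_order_rotate[OF \<pi>])
next
  let ?u = "Suc m - k"
  assume "(m, Suc m, ?u) \<in> \<pi>"
  then have last: "(?u, m, Suc m) \<in> \<pi>"
    using total_cyclic_order_rotate[OF \<pi>] by blast
  have "is_chain (restrict_order m \<pi>) [m - k..<m - k + k + 1]"
    using r unfolding A_hat_def by blast
  then have "is_chain (restrict_order m \<pi>) [m - k..<m + 1]" using k by simp
  then have ch: "(m - k, x, y) \<in> \<pi>" if "m - k < x" "x < y" "y \<le> m" for x y
    using that unfolding is_chain_upt_iff[OF total_cyclic_order_restrict[OF \<pi>]]
    by (auto simp: restrict_order_def)
  \<comment> \<open>The base point moves from \<open>m - k\<close> to \<open>?u\<close>: dropping
    the first element of a chain leaves a chain.\<close>
  have ch': "(?u, x, y) \<in> \<pi>" if "?u < x" "x < y" "y \<le> m" for x y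
    by (rule total_cyclic_order_trans(2)[OF \<pi> ch ch]) (use that k in auto)
  have "(?u, x, y) \<in> \<pi>" if "?u < x" "x < y" "y \<le> Suc m" for x y
  proof (cases "y = Suc m")
    case True
    show ?thesis
    proof (cases "x = m")
      case False
      then have "(?u, x, m) \<in> \<pi>" using that True by (intro ch') auto
      then show ?thesis using total_cyclic_order_trans(1)[OF \<pi> _ last] True by blast
    qed (use last True in simp)
  qed (use that ch' in auto)
  then show "is_chain \<pi> [?u..<Suc m + 1]"
    by (subst is_chain_upt_iff[OF \<pi>]) blast
qed

text \<open>The chain places \<open>Suc m\<close> on the arc from \<open>m\<close> to
  \<open>u\<close>. So the arcs between consecutive elements from \<open>u\<close> to
  \<open>m\<close> avoid it, the arc from \<open>m\<close> to \<open>u\<close> splits at it (the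
  \<open>+ 1\<close> accounts for its absence from \<open>\<rho>\<close>), and the arc from
  \<open>Suc m\<close> to \<open>Suc u\<close> passes through \<open>u\<close>.\<close>

lemma L_last_chain:
  assumes k: "2 \<le> k" "k \<le> m" and \<pi>: "total_cyclic_order (Suc m) \<pi>"
    and ch: "is_chain \<pi> [Suc m - k..<Suc m + 1]"
  defines "u \<equiv> Suc m - k" and "\<rho> \<equiv> restrict_order m \<pi>"
  shows "\<And>x. u \<le> x \<Longrightarrow> x < m \<Longrightarrow> L (Suc m) \<pi> x (Suc x) = L m \<rho> x (Suc x)"
    and "L m \<rho> m u + 1 = L (Suc m) \<pi> m (Suc m) + L (Suc m) \<pi> (Suc m) u"
    and "L (Suc m) \<pi> (Suc m) (Suc u) = L (Suc m) \<pi> (Suc m) u + L m \<rho> u (Suc u)"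
proof -
  note rot = total_cyclic_order_rotate[OF \<pi>]
  have c: "(u, x, y) \<in> \<pi>" if "u < x" "x < y" "y \<le> Suc m" for x y
    using ch that unfolding u_def by (subst (asm) is_chain_upt_iff[OF \<pi>]) auto
  have u: "Suc u \<le> m" using k by (auto simp: u_def)
  show A: "L (Suc m) \<pi> x (Suc x) = L m \<rho> x (Suc x)" if "u \<le> x" "x < m" for x
  proof -
    have "(x, Suc x, Suc m) \<in> \<pi>"
    proof (cases "x = u")
      case False
      then show ?thesis
        using that by (intro total_cyclic_order_trans(2)[OF \<pi> c c]) auto
    qed (use that c in auto)
    then have "(x, Suc m, Suc x) \<notin> \<pi>" by (rule total_cyclic_order_asym[OF \<pi>])
    then show ?thesis using L_restrict[of x m "Suc x" \<pi>] that by (simp add: \<rho>_def)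
  qed
  have m: "(m, Suc m, u) \<in> \<pi>" using u by (intro rot[OF c]) auto
  then show "L m \<rho> m u + 1 = L (Suc m) \<pi> m (Suc m) + L (Suc m) \<pi> (Suc m) u"
    using L_add[OF \<pi> m] L_restrict[of m m u \<pi>] u by (simp add: \<rho>_def)
  have "(Suc m, u, Suc u) \<in> \<pi>" using u by (intro rot[OF rot[OF c]]) auto
  then show "L (Suc m) \<pi> (Suc m) (Suc u) = L (Suc m) \<pi> (Suc m) u + L m \<rho> u (Suc u)"
    using L_add[OF \<pi>] A[of u] u by simp
qed

section \<open>Index tuples\<close>

text \<open>Substituting \<open>t = j - 1\<close> collects the truncated subtractions in the fixed
  starting point \<open>Suc m - k\<close>.\<close>

lemma A_check_iff:
  assumes "length i = k" "2 \<le> k" "k \<le> m"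
  shows "\<pi> \<in> A_check m i \<longleftrightarrow> \<pi> \<in> A_hat k m \<and>
    (\<forall>t<k - 1. L m \<pi> (Suc m - k + t) (Suc (Suc m - k + t)) = i ! t) \<and>
    L m \<pi> m (Suc m - k) = i ! (k - 1)"
proof -
  have "(\<forall>j\<in>{1..k - 1}. L m \<pi> (m + j - k) (m + 1 + j - k) = i ! (j - 1)) \<longleftrightarrow>
    (\<forall>t<k - 1. L m \<pi> (m + Suc t - k) (m + 1 + Suc t - k) = i ! (Suc t - 1))"
    (is "(\<forall>j\<in>_. ?P j) \<longleftrightarrow> (\<forall>t<_. ?P (Suc t))")
  proof -
    have "{1..k - 1} = Suc ` {..<k - 1}" by (simp only: image_Suc_lessThan)
    then show ?thesis by auto
  qed
  moreover have "m + Suc t - k = Suc m - k + t" "m + 1 + Suc t - k = Suc (Suc m - k + t)" for t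
    using assms by auto
  ultimately show ?thesis
    using assms(1) by (simp add: A_check_def Let_def)
qed

lemma finite_A_check: "finite (A_check m i)"
proof -
  have "A_check m i \<subseteq> Pow ({0..m} \<times> {0..m} \<times> {0..m})"
    by (auto simp: A_check_def A_hat_def total_cyclic_order_def Let_def)
  then show ?thesis by (rule finite_subset) simp
qed

lemma finite_T: "finite (T d N)"
proof -
  have "T d N \<subseteq> {i. set i \<subseteq> {0..N} \<and> length i = d + 1}"
    using member_le_sum_list by (fastforce simp: T_def)
  then show ?thesis by (rule finite_subset) (simp add: finite_lists_length_eq)
qed

text \<open>The rotation moves the last entry of \<open>i\<close> to the front, so the entry
  shortened by \<open>tau\<close> is \<open>i ! (k - 1)\<close> and the one enlarged is
  \<open>i ! (k - 2)\<close>. The additive form matches the relations of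
  \<open>L_last_chain\<close>, and membership in \<open>T\<close> follows from the other
  conditions.\<close>

lemma tau_rotated_iff:
  assumes i: "i \<in> T (k - 1) (N + 1)" and k: "2 \<le> k"
  shows "i' \<in> tau (k - 1) N (last i # butlast i) \<longleftrightarrow>
    length i' = k \<and> 1 \<le> i' ! 0 \<and> i' ! 0 < i ! (k - 1) \<and>
    i' ! (k - 1) + i' ! 0 + 1 = i ! (k - 2) + i ! (k - 1) \<and> (\<forall>t<k - 2. i' ! Suc t = i ! t)"
    (is "_ \<longleftrightarrow> ?R")
proof -
  \<comment> \<open>This \<open>d\<close> is \<open>k - 2\<close>, one less than the dimension
    argument of \<open>T\<close> and \<open>tau\<close>.\<close>
  obtain d where d: "k = Suc (Suc d)" using k by (metis add_2_eq_Suc le_Suc_ex)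
  have len: "length i = Suc (Suc d)" and pos: "\<And>t. t < Suc (Suc d) \<Longrightarrow> 1 \<le> i ! t"
    and sum: "sum_list i = N + 1"
    using i d by (auto simp: T_def)
  have last: "last i = i ! Suc d" using len by (metis One_nat_def diff_Suc_1 last_conv_nth length_0_conv nat.simps(3))
  have but: "butlast i ! t = i ! t" if "t \<le> d" for t
    using len that by (simp add: nth_butlast)
  have si: "(\<Sum>t<d. i ! t) + i ! d + i ! Suc d = N + 1"
    using sum len by (simp add: sum_list_sum_nth lessThan_atLeast0)
  have mid: "(\<forall>j\<in>{2..Suc d}. i' ! (j - 1) = (last i # butlast i) ! (j - 1)) \<longleftrightarrow>
      (\<forall>t<d. i' ! Suc t = i ! t)"
  proof
    assume A: "\<forall>j\<in>{2..Suc d}. i' ! (j - 1) = (last i # butlast i) ! (j - 1)"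
    show "\<forall>t<d. i' ! Suc t = i ! t"
    proof (intro allI impI)
      fix t assume "t < d"
      then show "i' ! Suc t = i ! t" using A[rule_format, of "Suc (Suc t)"] but[of t] by simp
    qed
  next
    assume A: "\<forall>t<d. i' ! Suc t = i ! t"
    show "\<forall>j\<in>{2..Suc d}. i' ! (j - 1) = (last i # butlast i) ! (j - 1)"
    proof
      fix j assume "j \<in> {2..Suc d}"
      moreover define t where "t = j - 2"
      ultimately have "j = Suc (Suc t)" "t < d" by auto
      then show "i' ! (j - 1) = (last i # butlast i) ! (j - 1)" using A but[of t] by simp
    qed
  qed
  \<comment> \<open>The last entry is at least \<open>i ! d\<close>, hence positive, because
    \<open>i' ! 0 < i ! Suc d\<close>; the additive equation lowers the total from
    \<open>N + 1\<close> to \<open>N\<close>.\<close>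
  have inT: "i' \<in> T (Suc d) N" if R: ?R
  proof -
    have len': "length i' = Suc (Suc d)" using R d by simp
    have "1 \<le> i' ! t" if "t < Suc (Suc d)" for t
    proof -
      consider "t = 0" | "t = Suc d" | s where "t = Suc s" "s < d"
      proof (cases t)
        case (Suc s)
        then show ?thesis using that(2,3) \<open>t < Suc (Suc d)\<close> by (cases "s = d") auto
      qed (use that in blast)
      then show ?thesis
      proof cases
        case 2
        then show ?thesis using R d pos[of d] by simp
      next
        case 3
        then show ?thesis using R d pos[of s] by simp
      qed (use R in simp)
    qed
    then have pos': "\<forall>x\<in>set i'. 1 \<le> x" using len' by (auto simp: in_set_conv_nth)
    have "sum_list i' = (\<Sum>t<Suc d. i' ! t) + i' ! Suc d"
      using len' by (simp add: sum_list_sum_nth lessThan_atLeast0)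
    then have "sum_list i' = i' ! 0 + (\<Sum>t<d. i' ! Suc t) + i' ! Suc d"
      by (simp only: sum.lessThan_Suc_shift)
    moreover have "(\<Sum>t<d. i' ! Suc t) = (\<Sum>t<d. i ! t)"
      using R d by (intro sum.cong) auto
    ultimately have "sum_list i' = N"
      using R d si by simp
    then show ?thesis using len' pos' by (simp add: T_def)
  qed
  have "i' \<in> tau (k - 1) N (last i # butlast i) \<longleftrightarrow> i' \<in> T (Suc d) N \<and> ?R"
  proof -
    have "i' \<in> tau (k - 1) N (last i # butlast i) \<longleftrightarrow> i' \<in> T (Suc d) N \<and>
      1 \<le> i' ! 0 \<and> i' ! 0 \<le> i ! Suc d - 1 \<and> i' ! Suc d = i ! d + i ! Suc d - i' ! 0 - 1 \<and>
      (\<forall>t<d. i' ! Suc t = i ! t)"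
      unfolding tau_def d using mid but[of d] last by simp
    \<comment> \<open>Positivity of the entries turns the truncated subtractions of
      \<open>tau\<close> into a strict inequality and an additive equation.\<close>
    also have "\<dots> \<longleftrightarrow> i' \<in> T (Suc d) N \<and> length i' = k \<and> 1 \<le> i' ! 0 \<and> i' ! 0 < i ! Suc d \<and>
      i' ! Suc d + i' ! 0 + 1 = i ! d + i ! Suc d \<and> (\<forall>t<d. i' ! Suc t = i ! t)"
      using pos[of "Suc d"] pos[of d] d by (auto simp: T_def)
    finally show ?thesis using d by simp
  qed
  then show ?thesis using inT by blast
qed

section \<open>Counting by deletion\<close>

text \<open>Deletion of \<open>Suc m\<close> is injective on \<open>A_check (Suc m) i\<close>, and
  its image is the disjoint union of the sets \<open>A_check m i'\<close> over the tuples of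
  \<open>tau\<close>.\<close>

lemma a_Suc:
  assumes k: "2 \<le> k" "k \<le> m" and i: "i \<in> T (k - 1) (Suc m + 1)"
  shows "a (Suc m) i = (\<Sum>i'\<in>tau (k - 1) (Suc m) (last i # butlast i). a m i')"
proof -
  let ?\<tau> = "tau (k - 1) (Suc m) (last i # butlast i)" and ?u = "Suc m - k"
  let ?r = "restrict_order m"
  note tau = tau_rotated_iff[OF i k(1)]
  have len: "length i = k" using i k by (auto simp: T_def)
  have pos: "1 \<le> i ! t" if "t < k" for t using i that len by (auto simp: T_def)
  have len': "length i' = k" if "i' \<in> ?\<tau>" for i' using that tau by blast
  \<comment> \<open>The arcs recorded for \<open>Suc m\<close> start at \<open>Suc ?u\<close>, those
    for \<open>m\<close> at \<open>?u\<close>; this shift by one is the source of the rotation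
    \<open>Omega\<close>.\<close>
  have Suc_u: "Suc (Suc m) - k + t = Suc (?u + t)" for t using k by auto
  note check = A_check_iff[OF len k(1) le_SucI[OF k(2)], unfolded Suc_u]
  have kk: "k - 1 = Suc (k - 2)" using k by simp
  have inj: "inj_on ?r (A_check (Suc m) i)"
  proof (rule inj_onI)
    fix \<pi> \<sigma> assume *: "\<pi> \<in> A_check (Suc m) i" "\<sigma> \<in> A_check (Suc m) i" "?r \<pi> = ?r \<sigma>"
    \<comment> \<open>The entry with \<open>t = k - 2\<close> is the distance from \<open>m\<close>
      to \<open>Suc m\<close>, so the tuple fixes the place of reinsertion.\<close>
    have "L (Suc m) \<rho> m (Suc m) = i ! (k - 2)" if "\<rho> \<in> A_check (Suc m) i" for \<rho>
    proof -
      have "Suc (?u + (k - 2)) = m" using k by simp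
      moreover have "k - 2 < k - 1" using k by simp
      ultimately show ?thesis using that unfolding check by metis
    qed
    moreover have "total_cyclic_order (Suc m) \<pi>" "total_cyclic_order (Suc m) \<sigma>"
      using * by (auto simp: check A_hat_def)
    ultimately show "\<pi> = \<sigma>"
      using * by (intro restrict_order_inj[of m \<pi> \<sigma> m]) auto
  qed
  have image: "?r ` A_check (Suc m) i = (\<Union>i'\<in>?\<tau>. A_check m i')"
  proof (intro set_eqI iffI)
    fix \<rho> assume "\<rho> \<in> ?r ` A_check (Suc m) i"
    then obtain \<pi> where \<pi>: "\<pi> \<in> A_check (Suc m) i" "\<rho> = ?r \<pi>" by blast
    have tot: "total_cyclic_order (Suc m) \<pi>" using \<pi>(1) by (auto simp: check A_hat_def)
    have hat: "?r \<pi> \<in> A_hat k m" and ch: "is_chain \<pi> [?u..<Suc m + 1]"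
      using A_hat_Suc_iff[OF k(2) tot] \<pi>(1) by (auto simp: check)
    note L = L_last_chain[OF k tot ch]
    have Li: "L (Suc m) \<pi> (Suc (?u + t)) (Suc (Suc (?u + t))) = i ! t" if "t < k - 1" for t
      using \<pi>(1) that by (simp add: check)
    have Lk: "L (Suc m) \<pi> (Suc m) (Suc ?u) = i ! (k - 1)"
      using \<pi>(1) Suc_u[of 0] by (simp add: check)
    \<comment> \<open>The tuple of arc lengths of \<open>\<rho>\<close>, the only index whose class
      can contain \<open>\<rho>\<close>.\<close>
    define i' where "i' = map (\<lambda>t. L m \<rho> (?u + t) (Suc (?u + t))) [0..<k - 1] @ [L m \<rho> m ?u]"
    have nth: "i' ! t = L m \<rho> (?u + t) (Suc (?u + t))" if "t < k - 1" for t
      using that by (simp add: i'_def nth_append)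
    have nthk: "i' ! (k - 1) = L m \<rho> m ?u" by (simp add: i'_def nth_append)
    have l': "length i' = k" using k by (simp add: i'_def)
    have i0: "i' ! 0 = L m \<rho> ?u (Suc ?u)" using nth[of 0] k by simp
    have lastL: "L (Suc m) \<pi> m (Suc m) = i ! (k - 2)"
      using Li[of "k - 2"] k by (simp add: numeral_2_eq_2 Suc_diff_Suc Suc_diff_le)
    have "i' ! Suc t = i ! t" if "t < k - 2" for t
    proof -
      have "?u + Suc t < m" using that k by auto
      then show ?thesis
        using nth[of "Suc t"] L(1)[of "?u + Suc t"] Li[of t] that \<pi>(2) by simp
    qed
    moreover have "1 \<le> i' ! 0" by (simp add: i0 L_def)
    \<comment> \<open>This summand of \<open>i ! (k - 1)\<close> makes the next inequality
      strict.\<close>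
    moreover have "1 \<le> L (Suc m) \<pi> (Suc m) ?u" by (simp add: L_def)
    then have "i' ! 0 < i ! (k - 1)" using L(3) Lk i0 \<pi>(2) by simp
    \<comment> \<open>The length from \<open>Suc m\<close> to \<open>?u\<close> is eliminated
      between the two splitting relations.\<close>
    moreover have "i' ! (k - 1) + i' ! 0 + 1 = i ! (k - 2) + i ! (k - 1)"
      using L(2,3) Lk i0 nthk lastL \<pi>(2) by simp
    ultimately have "i' \<in> ?\<tau>" unfolding tau using l' by blast
    moreover have "\<rho> \<in> A_check m i'"
      using hat nth nthk \<pi>(2) by (simp add: A_check_iff[OF l' k])
    ultimately show "\<rho> \<in> (\<Union>i'\<in>?\<tau>. A_check m i')" by blast
  next
    fix \<rho> assume "\<rho> \<in> (\<Union>i'\<in>?\<tau>. A_check m i')"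
    then obtain i' where i': "i' \<in> ?\<tau>" and \<rho>: "\<rho> \<in> A_check m i'" by blast
    note \<rho>' = \<rho>[unfolded A_check_iff[OF len'[OF i'] k]]
    have tot: "total_cyclic_order m \<rho>" using \<rho>' by (auto simp: A_hat_def)
    have c: "1 \<le> i ! (k - 2)" using pos[of "k - 2"] k by simp
    \<comment> \<open>The insertion distance after \<open>m\<close> must be
      \<open>i ! (k - 2)\<close>; by this bound the new element lands before \<open>?u\<close>, as
      the last chain requires.\<close>
    have c': "i ! (k - 2) \<le> L m \<rho> m ?u" using \<rho>' i' unfolding tau by simp
    have "L m \<rho> m ?u \<le> Suc m"
    proof -
      have "{h \<in> {0..m}. (m, h, ?u) \<in> \<rho>} \<subseteq> {0..<m}"
        using total_cyclic_order_distinct[OF tot] by fastforce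
      then have "card {h \<in> {0..m}. (m, h, ?u) \<in> \<rho>} \<le> m"
        using card_mono[of "{0..<m}"] by fastforce
      then show ?thesis by (simp add: L_def)
    qed
    with c' have "i ! (k - 2) \<le> Suc m" by simp
    then obtain \<pi> where \<pi>: "total_cyclic_order (Suc m) \<pi>" "?r \<pi> = \<rho>"
      "L (Suc m) \<pi> m (Suc m) = i ! (k - 2)"
      "\<And>x. x \<le> m \<Longrightarrow> x \<noteq> m \<Longrightarrow> i ! (k - 2) \<le> L m \<rho> m x \<Longrightarrow> (m, Suc m, x) \<in> \<pi>"
      using total_cyclic_order_insert[OF tot le_refl c] by blast
    have "(m, Suc m, ?u) \<in> \<pi>" using \<pi>(4)[of ?u] c' k by simp
    then have ch: "is_chain \<pi> [?u..<Suc m + 1]"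
      using last_chain_iff[OF k \<pi>(1)] \<pi>(2) \<rho>' by simp
    then have hat: "\<pi> \<in> A_hat k (Suc m)"
      using A_hat_Suc_iff[OF k(2) \<pi>(1)] \<pi>(2) \<rho>' by simp
    note L = L_last_chain[OF k \<pi>(1) ch, unfolded \<pi>(2)]
    \<comment> \<open>For \<open>t = k - 2\<close> this is the new arc from \<open>m\<close> to
      \<open>Suc m\<close>, set by the insertion; the other arcs are unchanged and recorded one
      place later in \<open>i'\<close>.\<close>
    have "L (Suc m) \<pi> (Suc (?u + t)) (Suc (Suc (?u + t))) = i ! t" if t: "t < k - 1" for t
    proof (cases "t = k - 2")
      case True
      then have "Suc (?u + t) = m" using k by simp
      then show ?thesis using \<pi>(3) True by simp
    next
      case False
      then have "?u + Suc t < m" "t < k - 2" "Suc t < k - 1" using t k by auto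
      moreover have "L m \<rho> (?u + Suc t) (Suc (?u + Suc t)) = i' ! Suc t"
        using \<rho>' calculation by blast
      ultimately show ?thesis
        using L(1)[of "?u + Suc t"] i' unfolding tau by simp
    qed
    moreover have "L (Suc m) \<pi> (Suc m) (Suc ?u) = i ! (k - 1)"
    proof -
      have "L m \<rho> ?u (Suc ?u) = i' ! 0"
        using \<rho>' k by (metis add.right_neutral kk zero_less_Suc)
      moreover have "i' ! (k - 1) + i' ! 0 + 1 = i ! (k - 2) + i ! (k - 1)"
        using i' unfolding tau by blast
      ultimately show ?thesis using L(2,3) \<pi>(3) \<rho>' by simp
    qed
    ultimately have "\<pi> \<in> A_check (Suc m) i"
      using hat Suc_u[of 0] by (simp add: check)
    then show "\<rho> \<in> ?r ` A_check (Suc m) i" using \<pi>(2) by blast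
  qed
  \<comment> \<open>Every entry of an index is an arc length of the order, so the order determines
    its index.\<close>
  have disj: "A_check m i' \<inter> A_check m i'' = {}"
    if "i' \<in> ?\<tau>" "i'' \<in> ?\<tau>" "i' \<noteq> i''" for i' i''
  proof (rule ccontr)
    assume "A_check m i' \<inter> A_check m i'' \<noteq> {}"
    then obtain \<rho> where "\<rho> \<in> A_check m i'" "\<rho> \<in> A_check m i''" by blast
    then have "i' ! t = i'' ! t" if "t < k" for t
      using that k \<open>i' \<in> ?\<tau>\<close> \<open>i'' \<in> ?\<tau>\<close> 
      by (cases "t = k - 1") (auto simp: A_check_iff[OF len' k])
    then have "i' = i''"
      using len' that k by (intro nth_equalityI) auto
    then show False using that by blast
  qed
  have "finite ?\<tau>" using finite_T by (rule finite_subset[rotated]) (auto simp: tau_def)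
  have "a (Suc m) i = card (\<Union>i'\<in>?\<tau>. A_check m i')"
    unfolding a_def image[symmetric] by (rule card_image[OF inj, symmetric])
  also have "\<dots> = (\<Sum>i'\<in>?\<tau>. a m i')"
    unfolding a_def using disj by (intro card_UN_disjoint[OF \<open>finite ?\<tau>\<close>]) (auto simp: finite_A_check)
  finally show ?thesis .
qed

theorem theorem7p4:
  fixes n k :: nat
  assumes "n \<ge> 3" and "2 \<le> k" and "k \<le> n - 1"
  shows "(\<lambda>i\<in>T (k - 1) (n + 1). a n i) =
         (Omega (k - 1) (n + 1) \<circ> Psi (k - 1) n) (\<lambda>i\<in>T (k - 1) n. a (n - 1) i)"
proof
  fix i
  define m where "m = n - 1"
  have n: "n = Suc m" "k \<le> m" using assms by (auto simp: m_def)
  show "(\<lambda>i\<in>T (k - 1) (n + 1). a n i) i =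
    (Omega (k - 1) (n + 1) \<circ> Psi (k - 1) n) (\<lambda>i\<in>T (k - 1) n. a (n - 1) i) i"
  proof (cases "i \<in> T (k - 1) (n + 1)")
    case True
    then have "i \<noteq> []" by (auto simp: T_def)
    then obtain xs x where i: "i = xs @ [x]" by (metis rev_exhaust)
    have rot: "last i # butlast i \<in> T (k - 1) (n + 1)"
      using True by (auto simp: T_def i)
    have "a n i = (\<Sum>i'\<in>tau (k - 1) n (last i # butlast i). a m i')"
      using a_Suc[OF assms(2) n(2)] True n(1) by simp
    \<comment> \<open>All tuples of \<open>tau\<close> lie in \<open>T (k - 1) n\<close>, where the
      restricted array agrees with \<open>a m\<close>.\<close>
    also have "\<dots> = (\<Sum>i'\<in>tau (k - 1) n (last i # butlast i).
        (\<lambda>i\<in>T (k - 1) n. a (n - 1) i) i')"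
      by (rule sum.cong) (auto simp: tau_def m_def)
    finally show ?thesis using True rot by (simp add: Omega_def Psi_def)
  \<comment> \<open>Outside the index set both arrays take the value
    \<open>undefined\<close>.\<close>
  qed (simp add: Omega_def)
qed

end
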